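(* Let $V$ be a countable (finite or infinite) set with at least two elements. Let $(K_t)_{t\ge 1}$ be a sequence of irreducible aperiodic Markov transition operators on $V$ and $(\pi_t)_{t\ge 1}$ a sequence of finite measures on $V$ such that $\{(K_t,\pi_t)\}_{t\ge 1}$ is a finite non-decreasing environment. Let $\gamma_t=\gamma(K_t^*K_t)$ be the Poincaré constant of $K_t^*K_t$, where $K_t^*$ is the adjoint of $K_t$ on $\ell^2(\tilde\pi_t)$, and let $\tilde\pi_1=\pi_1/\pi_1(V)$. Then for all $x,y\in V$, $$\forall t\ge 1,\quad d_{TV}(\mu_t^x,\mu_t^y)\le \frac12\sqrt{\frac{\pi_t(V)}{\pi_1(V)}}\left(\frac{1}{\sqrt{\tilde\pi_1(x)}}+\frac{1}{\sqrt{\tilde\pi_1(y)}}\right)\prod_{s=1}^t\sqrt{1-\gamma_s}.$$ Therefore, for all $\eta\in(0,1)$, $$T_{\mathrm{mer}}(x,y,\eta)\le \min\left\{t\ge 1 \;\Big|\; \frac12\sqrt{\frac{\pi_t(V)}{\pi_1(V)}}\left(\frac{1}{\sqrt{\tilde\pi_1(x)}}+\frac{1}{\sqrt{\tilde\pi_1(y)}}\right)\prod_{s=1}^t\sqrt{1-\gamma_s}\le\eta\right\},$$ with the convention $\min\emptyset=+\infty$.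
   Context: A Markov transition operator $K$ on $V$ is a map $K:V\times V\to[0,1]$ with $\sum_y K(x,y)=1$ for all $x$; it acts on functions by $(Kf)(x)=\sum_y K(x,y)f(y)$ and on measures by $(\mu K)(y)=\sum_x\mu(x)K(x,y)$. Finite non-decreasing environment: $\{(K_t,\pi_t)\}_{t\ge1}$ is one if the $\pi_t$ are positive measures ($\pi_t(x)>0$ for all $x$) with, for all $t\ge1$: $\pi_tK_t=\pi_t$; $\pi_t(V)<+\infty$; $\pi_{t+1}(x)\ge\pi_t(x)$ for all $x\in V$. The $\pi_t$ need not be probability measures. For a finite measure $\pi$, $\tilde\pi:=\pi/\pi(V)$. Law of the chain: $\mu_t^x$ is the law at time $t$ of the chain $(X_t)$ with $X_0=x$ and $\mathbb P(X_{t+1}=z\mid X_t)=K_{t+1}(X_t,z)$, i.e. $\mu_t^x=\delta_xK_1K_2\cdots K_t$. Total variation: $d_{TV}(\mu,\nu)=\frac12\sum_{x\in V}|\mu(x)-\nu(x)|$. Merging time: $T_{\mathrm{mer}}(x,y,\eta)=\inf\{t\ge1\mid d_{TV}(\mu_t^x,\mu_t^y)\le\eta\}$, with $\inf\emptyset=+\infty$. Poincaré constant: if $K$ has invariant probability $\tilde\pi$, $K^*$ is its adjoint on $\ell^2(\tilde\pi)$ and $Q=K^*K$. Set $\mathcal E_{Q,\tilde\pi}(f,f)=\langle (I-Q)f,f\rangle_{\tilde\pi}=\frac12\sum_{x,y}(f(x)-f(y))^2\tilde\pi(x)Q(x,y)$ and $\operatorname{Var}_{\tilde\pi}(f)=\tilde\pi(f^2)-\tilde\pi(f)^2$.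 Then $\gamma(Q)\ge0$ is the largest constant $\gamma$ such that $\gamma\operatorname{Var}_{\tilde\pi}(f)\le\mathcal E_{Q,\tilde\pi}(f,f)$ for all $f\in\ell^2(\tilde\pi)$. *)

theory Defs
  imports "HOL-Analysis.Infinite_Sum" "HOL-Library.Extended_Nat"
begin

text \<open>Measures on \<open>V\<close> are given by their point masses, and kernels, measures and functions are
  only ever evaluated on the carrier \<open>V\<close>.\<close>

definition markov_kernel :: "'a set \<Rightarrow> ('a \<Rightarrow> 'a \<Rightarrow> real) \<Rightarrow> bool" where
  "markov_kernel V K \<longleftrightarrow>
     (\<forall>x\<in>V. \<forall>y\<in>V. 0 \<le> K x y \<and> K x y \<le> 1) \<and> (\<forall>x\<in>V. (K x has_sum 1) V)"

definition act_fun :: "'a set \<Rightarrow> ('a \<Rightarrow> 'a \<Rightarrow> real) \<Rightarrow> ('a \<Rightarrow> real) \<Rightarrow> 'a \<Rightarrow> real" where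
  "act_fun V K f x = (\<Sum>\<^sub>\<infinity>y\<in>V. K x y * f y)"

definition act_measure :: "'a set \<Rightarrow> ('a \<Rightarrow> real) \<Rightarrow> ('a \<Rightarrow> 'a \<Rightarrow> real) \<Rightarrow> 'a \<Rightarrow> real" where
  "act_measure V \<mu> K y = (\<Sum>\<^sub>\<infinity>x\<in>V. \<mu> x * K x y)"

definition point_mass :: "'a \<Rightarrow> 'a \<Rightarrow> real" where
  "point_mass x y = (if y = x then 1 else 0)"

fun kernel_power :: "'a set \<Rightarrow> ('a \<Rightarrow> 'a \<Rightarrow> real) \<Rightarrow> nat \<Rightarrow> 'a \<Rightarrow> 'a \<Rightarrow> real" where
  "kernel_power V K 0 x = point_mass x"
| "kernel_power V K (Suc n) x = act_measure V (kernel_power V K n x) K"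

definition irreducible_kernel :: "'a set \<Rightarrow> ('a \<Rightarrow> 'a \<Rightarrow> real) \<Rightarrow> bool" where
  "irreducible_kernel V K \<longleftrightarrow> (\<forall>x\<in>V. \<forall>y\<in>V. \<exists>n. kernel_power V K n x y > 0)"

definition aperiodic_kernel :: "'a set \<Rightarrow> ('a \<Rightarrow> 'a \<Rightarrow> real) \<Rightarrow> bool" where
  "aperiodic_kernel V K \<longleftrightarrow> (\<forall>x\<in>V. Gcd {n. 1 \<le> n \<and> kernel_power V K n x x > 0} = 1)"

definition mass :: "'a set \<Rightarrow> ('a \<Rightarrow> real) \<Rightarrow> real" where
  "mass V \<pi> = (\<Sum>\<^sub>\<infinity>x\<in>V. \<pi> x)"

definition normalized :: "'a set \<Rightarrow> ('a \<Rightarrow> real) \<Rightarrow> 'a \<Rightarrow> real" where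
  "normalized V \<pi> x = \<pi> x / mass V \<pi>"

text \<open>For a nonnegative \<open>\<pi>\<close>, summability over \<open>V\<close> expresses \<open>\<pi>(V) < \<infinity>\<close>. Time starts at 1; the
  values of \<open>K\<close> and \<open>\<pi>\<close> at index 0 are irrelevant.\<close>

definition finite_nondecreasing_environment ::
    "'a set \<Rightarrow> (nat \<Rightarrow> 'a \<Rightarrow> 'a \<Rightarrow> real) \<Rightarrow> (nat \<Rightarrow> 'a \<Rightarrow> real) \<Rightarrow> bool" where
  "finite_nondecreasing_environment V K \<pi> \<longleftrightarrow>
     (\<forall>t\<ge>1. (\<forall>x\<in>V. \<pi> t x > 0) \<and>
            (\<forall>x\<in>V. act_measure V (\<pi> t) (K t) x = \<pi> t x) \<and>
            \<pi> t summable_on V \<and>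
            (\<forall>x\<in>V. \<pi> (t + 1) x \<ge> \<pi> t x))"

fun chain_law :: "'a set \<Rightarrow> (nat \<Rightarrow> 'a \<Rightarrow> 'a \<Rightarrow> real) \<Rightarrow> 'a \<Rightarrow> nat \<Rightarrow> 'a \<Rightarrow> real" where
  "chain_law V K x 0 = point_mass x"
| "chain_law V K x (Suc t) = act_measure V (chain_law V K x t) (K (Suc t))"

definition tv_dist :: "'a set \<Rightarrow> ('a \<Rightarrow> real) \<Rightarrow> ('a \<Rightarrow> real) \<Rightarrow> real" where
  "tv_dist V \<mu> \<nu> = 1/2 * (\<Sum>\<^sub>\<infinity>x\<in>V. \<bar>\<mu> x - \<nu> x\<bar>)"

text \<open>On \<open>enat\<close>, the infimum of the empty set is \<open>\<infinity>\<close> and the infimum of a nonempty set is its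
  minimum.\<close>

definition merging_time ::
    "'a set \<Rightarrow> (nat \<Rightarrow> 'a \<Rightarrow> 'a \<Rightarrow> real) \<Rightarrow> 'a \<Rightarrow> 'a \<Rightarrow> real \<Rightarrow> enat" where
  "merging_time V K x y \<eta> =
     Inf {enat t | t. 1 \<le> t \<and> tv_dist V (chain_law V K x t) (chain_law V K y t) \<le> \<eta>}"

definition l2_space :: "'a set \<Rightarrow> ('a \<Rightarrow> real) \<Rightarrow> ('a \<Rightarrow> real) set" where
  "l2_space V p = {f. (\<lambda>x. (f x)\<^sup>2 * p x) summable_on V}"

definition l2_inner :: "'a set \<Rightarrow> ('a \<Rightarrow> real) \<Rightarrow> ('a \<Rightarrow> real) \<Rightarrow> ('a \<Rightarrow> real) \<Rightarrow> real" where
  "l2_inner V p f g = (\<Sum>\<^sub>\<infinity>x\<in>V. f x * g x * p x)"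

definition is_l2_adjoint :: "'a set \<Rightarrow> ('a \<Rightarrow> real) \<Rightarrow> (('a \<Rightarrow> real) \<Rightarrow> 'a \<Rightarrow> real) \<Rightarrow>
    (('a \<Rightarrow> real) \<Rightarrow> 'a \<Rightarrow> real) \<Rightarrow> bool" where
  "is_l2_adjoint V p A B \<longleftrightarrow>
     (\<forall>g\<in>l2_space V p. B g \<in> l2_space V p \<and>
        (\<forall>f\<in>l2_space V p. l2_inner V p (A f) g = l2_inner V p f (B g)))"

text \<open>If \<open>p\<close> is positive on \<open>V\<close>, testing against point indicators shows that the values of \<open>B g\<close> on
  \<open>V\<close>, for \<open>g\<close> in the space, do not depend on the choice.\<close>

definition l2_adjoint :: "'a set \<Rightarrow> ('a \<Rightarrow> real) \<Rightarrow> (('a \<Rightarrow> real) \<Rightarrow> 'a \<Rightarrow> real) \<Rightarrow>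
    ('a \<Rightarrow> real) \<Rightarrow> 'a \<Rightarrow> real" where
  "l2_adjoint V p A = (SOME B. is_l2_adjoint V p A B)"

definition dirichlet_form ::
    "'a set \<Rightarrow> ('a \<Rightarrow> real) \<Rightarrow> (('a \<Rightarrow> real) \<Rightarrow> 'a \<Rightarrow> real) \<Rightarrow> ('a \<Rightarrow> real) \<Rightarrow> real" where
  "dirichlet_form V p Q f = l2_inner V p (\<lambda>x. f x - Q f x) f"

definition variance_of :: "'a set \<Rightarrow> ('a \<Rightarrow> real) \<Rightarrow> ('a \<Rightarrow> real) \<Rightarrow> real" where
  "variance_of V p f = (\<Sum>\<^sub>\<infinity>x\<in>V. (f x)\<^sup>2 * p x) - (\<Sum>\<^sub>\<infinity>x\<in>V. f x * p x)\<^sup>2"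

definition poincare_const ::
    "'a set \<Rightarrow> ('a \<Rightarrow> real) \<Rightarrow> (('a \<Rightarrow> real) \<Rightarrow> 'a \<Rightarrow> real) \<Rightarrow> real" where
  "poincare_const V p Q =
     (GREATEST c. \<forall>f\<in>l2_space V p. c * variance_of V p f \<le> dirichlet_form V p Q f)"

definition env_gamma ::
    "'a set \<Rightarrow> (nat \<Rightarrow> 'a \<Rightarrow> 'a \<Rightarrow> real) \<Rightarrow> (nat \<Rightarrow> 'a \<Rightarrow> real) \<Rightarrow> nat \<Rightarrow> real" where
  "env_gamma V K \<pi> t =
     (let p = normalized V (\<pi> t); A = act_fun V (K t)
      in poincare_const V p (l2_adjoint V p A \<circ> A))"

end

theory Submission
  imports Defs
begin

text \<open>Write \<open>S\<^sub>t(f)\<close> for the minimum over constants \<open>c\<close> of \<open>\<Sum> (f - c)\<^sup>2 \<pi>\<^sub>t\<close>, that is, \<open>\<pi>\<^sub>t(V)\<close> times the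
  variance of \<open>f\<close> under the normalized measure. Since \<open>K\<^sub>t\<close> preserves means, the Dirichlet form of
  \<open>K\<^sub>t\<^sup>* K\<^sub>t\<close> is the drop in variance from \<open>f\<close> to \<open>K\<^sub>t f\<close>, so \<open>S\<^sub>t(K\<^sub>t f) \<le> (1 - \<gamma>\<^sub>t) S\<^sub>t(f)\<close>; and \<open>S\<^sub>t\<close> is
  nondecreasing in \<open>t\<close> because \<open>\<pi>\<^sub>t\<close> is. Hence \<open>h = K\<^sub>1 \<cdots> K\<^sub>t f\<close>, whose value at \<open>x\<close> is \<open>\<mu>\<^sub>t\<^sup>x(f)\<close>,
  satisfies \<open>S\<^sub>1(h) \<le> \<Prod> (1 - \<gamma>\<^sub>s) S\<^sub>t(f)\<close>. A single term of \<open>S\<^sub>1(h)\<close> bounds the distance of \<open>h(x)\<close> to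
  the mean of \<open>h\<close>, and taking for \<open>f\<close> the sign of \<open>\<mu>\<^sub>t\<^sup>x - \<mu>\<^sub>t\<^sup>y\<close> gives the total variation bound.\<close>

section \<open>Summation and Markov kernels\<close>

lemma summable_on_dominated:
  fixes f g :: "'a \<Rightarrow> real"
  assumes "g summable_on A" and "\<And>x. x \<in> A \<Longrightarrow> \<bar>f x\<bar> \<le> g x"
  shows "f summable_on A"
  using abs_summable_on_comparison_test'[of g A f] assms
    summable_on_iff_abs_summable_on_real[of f A] by simp

lemma summable_on_abs:
  fixes f :: "'a \<Rightarrow> real"
  shows "f summable_on A \<Longrightarrow> (\<lambda>x. \<bar>f x\<bar>) summable_on A"
  using summable_on_iff_abs_summable_on_real[of f A] by simp

lemma has_sum_diff_real:
  fixes f g :: "'a \<Rightarrow> real"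
  assumes "(f has_sum a) A" and "(g has_sum b) A"
  shows "((\<lambda>x. f x - g x) has_sum (a - b)) A"
  using has_sum_add[OF assms(1) has_sum_uminusI[OF assms(2)]] by simp

lemma abs_le_one_plus_square: "\<bar>a::real\<bar> \<le> 1 + a\<^sup>2"
  using sum_squares_bound[of 1 "\<bar>a\<bar>"] by (simp add: power2_eq_square)

lemma abs_mult_le_squares: "\<bar>a * b :: real\<bar> \<le> a\<^sup>2 + b\<^sup>2"
proof -
  have "2 * \<bar>a * b\<bar> \<le> a\<^sup>2 + b\<^sup>2"
    using sum_squares_bound[of "\<bar>a\<bar>" "\<bar>b\<bar>"] by (simp add: abs_mult)
  then show ?thesis using abs_ge_zero[of "a * b"] by linarith
qed

section \<open>Markov kernels acting on measures and on bounded functions\<close>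

lemma markov_kernel_nonneg: "markov_kernel V K \<Longrightarrow> x \<in> V \<Longrightarrow> y \<in> V \<Longrightarrow> 0 \<le> K x y"
  and markov_kernel_le_1: "markov_kernel V K \<Longrightarrow> x \<in> V \<Longrightarrow> y \<in> V \<Longrightarrow> K x y \<le> 1"
  and markov_kernel_has_sum: "markov_kernel V K \<Longrightarrow> x \<in> V \<Longrightarrow> (K x has_sum 1) V"
  by (auto simp: markov_kernel_def)

text \<open>Each row of \<open>K\<close> sums to 1, so the double family has total
  \<open>\<Sum> \<bar>\<mu> x\<bar>\<close>. It is the dominating family behind several of the
  Fubini arguments below.\<close>

lemma markov_kernel_joint_summable:
  assumes K: "markov_kernel V K" and \<mu>: "\<mu> summable_on V"
  shows "(\<lambda>(x, y). \<bar>\<mu> x\<bar> * K x y) summable_on V \<times> V"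
proof (rule summable_on_SigmaI)
  fix x assume "x \<in> V"
  then show "((\<lambda>y. case (x, y) of (x, y) \<Rightarrow> \<bar>\<mu> x\<bar> * K x y) has_sum \<bar>\<mu> x\<bar>) V"
    using has_sum_cmult_right[OF markov_kernel_has_sum[OF K], of x "\<bar>\<mu> x\<bar>"] by simp
qed (use summable_on_abs[OF \<mu>] markov_kernel_nonneg[OF K] in auto)

lemma act_fun_abs_le:
  assumes K: "markov_kernel V K" and f: "\<And>y. y \<in> V \<Longrightarrow> \<bar>f y\<bar> \<le> 1" and x: "x \<in> V"
  shows "\<bar>act_fun V K f x\<bar> \<le> 1"
proof -
  have bd: "\<bar>K x y * f y\<bar> \<le> K x y" if "y \<in> V" for y
    using markov_kernel_nonneg[OF K x that] f[OF that] by (simp add: abs_mult mult_left_le)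
  have s: "(\<lambda>y. K x y * f y) summable_on V"
    using summable_on_dominated[OF has_sum_imp_summable[OF markov_kernel_has_sum[OF K x]] bd] .
  have "act_fun V K f x \<le> 1" unfolding act_fun_def
    using bd by (intro has_sum_mono[OF has_sum_infsum[OF s] markov_kernel_has_sum[OF K x]])
      (auto simp: abs_le_iff)
  moreover have "-1 \<le> act_fun V K f x" unfolding act_fun_def
  proof (rule has_sum_mono[OF has_sum_uminusI[OF markov_kernel_has_sum[OF K x]] has_sum_infsum[OF s]])
    show "- K x y \<le> K x y * f y" if "y \<in> V" for y
      using bd[OF that] by linarith
  qed
  ultimately show ?thesis by (simp add: abs_le_iff)
qed

text \<open>Fubini: with \<open>f\<close> bounded by 1 the summands are dominated by
  \<open>\<bar>\<mu> x\<bar> * K x y\<close>, so both orders of summation agree. The measure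
  \<open>\<mu>\<close> may be signed.\<close>

lemma
  assumes K: "markov_kernel V K" and \<mu>: "\<mu> summable_on V"
    and f: "\<And>y. y \<in> V \<Longrightarrow> \<bar>f y\<bar> \<le> 1"
  shows act_measure_summable: "act_measure V \<mu> K summable_on V"
    and act_measure_duality:
      "(\<Sum>\<^sub>\<infinity>y\<in>V. act_measure V \<mu> K y * f y) = (\<Sum>\<^sub>\<infinity>x\<in>V. \<mu> x * act_fun V K f x)"
proof -
  have joint: "(\<lambda>(x, y). \<mu> x * K x y * g y) summable_on V \<times> V"
    if "\<And>y. y \<in> V \<Longrightarrow> \<bar>g y\<bar> \<le> 1" for g
  proof (rule summable_on_dominated[OF markov_kernel_joint_summable[OF K \<mu>]])
    fix z assume "z \<in> V \<times> V"
    then obtain x y where z: "z = (x, y)" "x \<in> V" "y \<in> V" by auto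
    show "\<bar>case z of (x, y) \<Rightarrow> \<mu> x * K x y * g y\<bar> \<le> (case z of (x, y) \<Rightarrow> \<bar>\<mu> x\<bar> * K x y)"
      using markov_kernel_nonneg[OF K z(2,3)] mult_left_le[OF that[OF z(3)], of "\<bar>\<mu> x\<bar> * K x y"] z(1)
      by (simp add: abs_mult)
  qed
  have "(\<lambda>(y, x). \<mu> x * K x y) summable_on V \<times> V"
    using joint[of "\<lambda>_. 1"] by (subst summable_on_swap) simp
  then show "act_measure V \<mu> K summable_on V"
    using summable_on_Sigma_banach[of "\<lambda>y x. \<mu> x * K x y" V "\<lambda>_. V"]
    by (simp add: act_measure_def[abs_def])
  have "(\<Sum>\<^sub>\<infinity>y\<in>V. act_measure V \<mu> K y * f y) = (\<Sum>\<^sub>\<infinity>y\<in>V. \<Sum>\<^sub>\<infinity>x\<in>V. \<mu> x * K x y * f y)"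
    by (simp add: act_measure_def infsum_cmult_left')
  also have "\<dots> = (\<Sum>\<^sub>\<infinity>x\<in>V. \<Sum>\<^sub>\<infinity>y\<in>V. \<mu> x * K x y * f y)"
    by (rule infsum_swap_banach[symmetric]) (rule joint[OF f])
  also have "\<dots> = (\<Sum>\<^sub>\<infinity>x\<in>V. \<mu> x * act_fun V K f x)"
    by (simp add: act_fun_def mult.assoc infsum_cmult_right')
  finally show "(\<Sum>\<^sub>\<infinity>y\<in>V. act_measure V \<mu> K y * f y) = (\<Sum>\<^sub>\<infinity>x\<in>V. \<mu> x * act_fun V K f x)" .
qed

section \<open>Minimal square deviation\<close>

text \<open>Mass of \<open>p\<close> times the variance under the normalized measure. It stays
  unnormalized because this version grows with \<open>p\<close> (see
  \<open>spread_mono\<close>).\<close>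

definition spread :: "'a set \<Rightarrow> ('a \<Rightarrow> real) \<Rightarrow> ('a \<Rightarrow> real) \<Rightarrow> real" where
  "spread V p f = (\<Sum>\<^sub>\<infinity>x\<in>V. (f x)\<^sup>2 * p x) - (\<Sum>\<^sub>\<infinity>x\<in>V. f x * p x)\<^sup>2 / mass V p"

lemma spread_cong: "(\<And>x. x \<in> V \<Longrightarrow> f x = g x) \<Longrightarrow> spread V p f = spread V p g"
  unfolding spread_def by (simp cong: infsum_cong)

lemma l2_space_summable:
  assumes p: "\<And>x. x \<in> V \<Longrightarrow> 0 \<le> p x" "p summable_on V" and f: "f \<in> l2_space V p"
  shows "(\<lambda>x. f x * p x) summable_on V"
proof (rule summable_on_dominated)
  show "(\<lambda>x. p x + (f x)\<^sup>2 * p x) summable_on V"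
    using p f by (auto simp: l2_space_def intro: summable_on_add)
  show "\<bar>f x * p x\<bar> \<le> p x + (f x)\<^sup>2 * p x" if "x \<in> V" for x
    using mult_right_mono[OF abs_le_one_plus_square[of "f x"] p(1)[OF that]] p(1)[OF that]
    by (simp add: abs_mult algebra_simps)
qed

lemma l2_space_bounded:
  assumes "\<And>x. x \<in> V \<Longrightarrow> 0 \<le> p x" "p summable_on V" and "\<And>x. x \<in> V \<Longrightarrow> \<bar>f x\<bar> \<le> 1"
  shows "f \<in> l2_space V p"
  unfolding l2_space_def mem_Collect_eq
proof (rule summable_on_dominated[OF assms(2)])
  fix x assume x: "x \<in> V"
  have "(f x)\<^sup>2 \<le> 1" using assms(3)[OF x] by (simp add: abs_square_le_1)
  then show "\<bar>(f x)\<^sup>2 * p x\<bar> \<le> p x"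
    using assms(1)[OF x] by (simp add: abs_mult mult_left_le_one_le)
qed

lemma square_deviation_has_sum:
  assumes p: "\<And>x. x \<in> V \<Longrightarrow> 0 \<le> p x" "p summable_on V" and f: "f \<in> l2_space V p"
  shows "((\<lambda>x. (f x - c)\<^sup>2 * p x) has_sum
      (\<Sum>\<^sub>\<infinity>x\<in>V. (f x)\<^sup>2 * p x) - 2 * c * (\<Sum>\<^sub>\<infinity>x\<in>V. f x * p x) + c\<^sup>2 * mass V p) V"
proof -
  have "((\<lambda>x. (f x)\<^sup>2 * p x - 2 * c * (f x * p x) + c\<^sup>2 * p x) has_sum
      (\<Sum>\<^sub>\<infinity>x\<in>V. (f x)\<^sup>2 * p x) - 2 * c * (\<Sum>\<^sub>\<infinity>x\<in>V. f x * p x) + c\<^sup>2 * mass V p) V"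
    unfolding mass_def using p f l2_space_summable[OF p f]
    by (intro has_sum_add has_sum_diff_real has_sum_cmult_right has_sum_infsum)
      (auto simp: l2_space_def)
  then show ?thesis
    by (simp add: power2_eq_square algebra_simps)
qed

lemma mass_pos:
  assumes "\<And>x. x \<in> V \<Longrightarrow> 0 < p x" "p summable_on V" "V \<noteq> {}"
  shows "0 < mass V p"
proof -
  obtain a where a: "a \<in> V" using assms(3) by auto
  have "sum p {a} \<le> mass V p" unfolding mass_def
    using assms a by (intro finite_sum_le_infsum) (auto intro: less_imp_le)
  then show ?thesis using assms(1)[OF a] by simp
qed

lemma spread_has_sum:
  assumes p: "\<And>x. x \<in> V \<Longrightarrow> 0 \<le> p x" "p summable_on V" and f: "f \<in> l2_space V p"
    and M: "0 < mass V p"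
  shows "((\<lambda>x. (f x - (\<Sum>\<^sub>\<infinity>x\<in>V. f x * p x) / mass V p)\<^sup>2 * p x) has_sum spread V p f) V"
proof -
  let ?m = "\<Sum>\<^sub>\<infinity>x\<in>V. f x * p x"
  have "(\<Sum>\<^sub>\<infinity>x\<in>V. (f x)\<^sup>2 * p x) - 2 * (?m / mass V p) * ?m + (?m / mass V p)\<^sup>2 * mass V p = spread V p f"
    using M by (simp add: spread_def field_simps power2_eq_square)
  then show ?thesis
    using square_deviation_has_sum[OF p f, of "?m / mass V p"] by simp
qed

lemma spread_nonneg:
  assumes "\<And>x. x \<in> V \<Longrightarrow> 0 \<le> p x" "p summable_on V" "f \<in> l2_space V p" "0 < mass V p"
  shows "0 \<le> spread V p f"
  using assms(1) by (intro has_sum_nonneg[OF spread_has_sum[OF assms]]) auto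

text \<open>The mean is the best centre: completing the square, the deviation about \<open>c\<close>
  exceeds the spread by \<open>(?m / mass V p - c)\<^sup>2 * mass V p\<close>.\<close>

lemma spread_le_square_deviation:
  assumes p: "\<And>x. x \<in> V \<Longrightarrow> 0 \<le> p x" "p summable_on V" and f: "f \<in> l2_space V p"
    and M: "0 < mass V p" and d: "((\<lambda>x. (f x - c)\<^sup>2 * p x) has_sum d) V"
  shows "spread V p f \<le> d"
proof -
  let ?m = "\<Sum>\<^sub>\<infinity>x\<in>V. f x * p x"
  have "d = (\<Sum>\<^sub>\<infinity>x\<in>V. (f x)\<^sup>2 * p x) - 2 * c * ?m + c\<^sup>2 * mass V p"
    using has_sum_unique[OF d square_deviation_has_sum[OF p f]] .
  then have "d - spread V p f = ?m\<^sup>2 / mass V p - 2 * c * ?m + c\<^sup>2 * mass V p"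
    by (simp add: spread_def)
  also have "\<dots> = (?m / mass V p - c)\<^sup>2 * mass V p"
    using M by (simp add: power2_diff power_divide field_simps power2_eq_square)
  finally have "d - spread V p f = (?m / mass V p - c)\<^sup>2 * mass V p" .
  moreover have "0 \<le> (?m / mass V p - c)\<^sup>2 * mass V p" using M by simp
  ultimately show ?thesis by linarith
qed

text \<open>Both deviations are taken about the mean \<open>?c\<close> of the larger measure
  \<open>q\<close>. For \<open>p\<close> this centre is only suboptimal, which bounds the spread
  from above, and then the sums compare term by term.\<close>

lemma spread_mono:
  assumes p: "\<And>x. x \<in> V \<Longrightarrow> 0 \<le> p x" "p summable_on V" "0 < mass V p"
    and q: "\<And>x. x \<in> V \<Longrightarrow> p x \<le> q x" "q summable_on V" "0 < mass V q"
    and f: "f \<in> l2_space V q"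
  shows "spread V p f \<le> spread V q f"
proof -
  let ?c = "(\<Sum>\<^sub>\<infinity>x\<in>V. f x * q x) / mass V q"
  have q0: "0 \<le> q x" if "x \<in> V" for x using p(1)[OF that] q(1)[OF that] by linarith
  have "(\<lambda>x. (f x)\<^sup>2 * p x) summable_on V"
  proof (rule summable_on_dominated)
    show "(\<lambda>x. (f x)\<^sup>2 * q x) summable_on V" using f by (simp add: l2_space_def)
  qed (use p(1) q(1) in \<open>simp add: abs_mult mult_left_mono\<close>)
  then have fp: "f \<in> l2_space V p" by (simp add: l2_space_def)
  note d = square_deviation_has_sum[OF p(1,2) fp, of ?c]
  have "spread V p f \<le> (\<Sum>\<^sub>\<infinity>x\<in>V. (f x)\<^sup>2 * p x) - 2 * ?c * (\<Sum>\<^sub>\<infinity>x\<in>V. f x * p x) + ?c\<^sup>2 * mass V p"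
    by (rule spread_le_square_deviation[OF p(1,2) fp p(3) d])
  also have "\<dots> \<le> spread V q f"
    using q(1) by (intro has_sum_mono[OF d spread_has_sum[OF q0 q(2) f q(3)]]) (auto intro: mult_left_mono)
  finally show ?thesis .
qed

lemma spread_bounded_le_mass:
  assumes p: "\<And>x. x \<in> V \<Longrightarrow> 0 \<le> p x" "p summable_on V" "0 < mass V p"
    and f: "\<And>x. x \<in> V \<Longrightarrow> \<bar>f x\<bar> \<le> 1"
  shows "spread V p f \<le> mass V p"
proof -
  have "f \<in> l2_space V p" using p f by (intro l2_space_bounded) auto
  then have "(\<Sum>\<^sub>\<infinity>x\<in>V. (f x)\<^sup>2 * p x) \<le> mass V p"
    unfolding mass_def using p f
    by (intro infsum_mono) (auto simp: l2_space_def abs_square_le_1 mult_left_le_one_le)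
  moreover have "0 \<le> (\<Sum>\<^sub>\<infinity>x\<in>V. f x * p x)\<^sup>2 / mass V p" using p(3) by simp
  ultimately show ?thesis by (simp add: spread_def)
qed

lemma deviation_le_spread:
  assumes p: "\<And>x. x \<in> V \<Longrightarrow> 0 < p x" "p summable_on V" and f: "f \<in> l2_space V p" and x: "x \<in> V"
  shows "\<bar>f x - (\<Sum>\<^sub>\<infinity>x\<in>V. f x * p x) / mass V p\<bar> \<le> sqrt (spread V p f) / sqrt (p x)"
proof -
  have p0: "0 \<le> p x" if "x \<in> V" for x using p(1)[OF that] by simp
  have M: "0 < mass V p" using mass_pos[OF p] x by blast
  let ?d = "f x - (\<Sum>\<^sub>\<infinity>x\<in>V. f x * p x) / mass V p"
  have "?d\<^sup>2 * p x \<le> spread V p f"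
    using finite_sum_le_has_sum[OF spread_has_sum[OF p0 p(2) f M], of "{x}"] x p0 by simp
  then have "sqrt (?d\<^sup>2 * p x) \<le> sqrt (spread V p f)" by (rule real_sqrt_le_mono)
  then show ?thesis
    using p(1)[OF x] by (simp add: real_sqrt_mult field_simps)
qed

section \<open>Variance under the normalized measure\<close>

lemma mass_normalized: "0 < mass V p \<Longrightarrow> mass V (normalized V p) = 1"
  unfolding mass_def normalized_def divide_inverse by (simp add: infsum_cmult_left')

lemma variance_of_normalized:
  "variance_of V (normalized V p) f = spread V p f / mass V p"
proof -
  have "(\<Sum>\<^sub>\<infinity>x\<in>V. g x * (p x / mass V p)) = (\<Sum>\<^sub>\<infinity>x\<in>V. g x * p x) / mass V p" for g
    unfolding divide_inverse by (simp add: infsum_cmult_left' flip: mult.assoc)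
  then have "variance_of V (normalized V p) f =
      (\<Sum>\<^sub>\<infinity>x\<in>V. (f x)\<^sup>2 * p x) / mass V p - ((\<Sum>\<^sub>\<infinity>x\<in>V. f x * p x) / mass V p)\<^sup>2"
    by (simp only: variance_of_def normalized_def)
  then show ?thesis
    by (simp add: spread_def diff_divide_distrib power2_eq_square)
qed

lemma variance_of_eq_spread: "mass V p = 1 \<Longrightarrow> variance_of V p f = spread V p f"
  by (simp add: variance_of_def spread_def)

section \<open>Kernels with an invariant measure\<close>

locale invariant_kernel =
  fixes V :: "'a set" and K :: "'a \<Rightarrow> 'a \<Rightarrow> real" and p :: "'a \<Rightarrow> real"
  assumes markov: "markov_kernel V K"
    and pos: "\<And>x. x \<in> V \<Longrightarrow> 0 < p x"
    and summable: "p summable_on V"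
    and invariant: "\<And>x. x \<in> V \<Longrightarrow> act_measure V p K x = p x"
begin

lemma nonneg: "x \<in> V \<Longrightarrow> 0 \<le> p x"
  using pos by (simp add: less_imp_le)

lemma flow_nonneg: "x \<in> V \<Longrightarrow> y \<in> V \<Longrightarrow> 0 \<le> p x * K x y"
  using markov_kernel_nonneg[OF markov] nonneg by simp

lemma inflow_has_sum:
  assumes "y \<in> V"
  shows "((\<lambda>x. p x * K x y) has_sum p y) V"
proof -
  \<comment> \<open>Invariance only equates a value of \<open>infsum\<close>; domination by
    \<open>p\<close> makes it a genuine convergent sum.\<close>
  have "(\<lambda>x. p x * K x y) summable_on V"
  proof (rule summable_on_dominated[OF summable])
    fix x assume "x \<in> V"
    then show "\<bar>p x * K x y\<bar> \<le> p x"
      using markov_kernel_le_1[OF markov] flow_nonneg nonneg assms by (simp add: mult_left_le)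
  qed
  then show ?thesis
    using invariant[OF assms] has_sum_infsum unfolding act_measure_def by metis
qed

text \<open>The time reversal of \<open>K\<close> with respect to \<open>p\<close>; its action on
  functions is the adjoint of \<open>K\<close> (see \<open>reversed_is_l2_adjoint\<close>).\<close>

definition reversed :: "'a \<Rightarrow> 'a \<Rightarrow> real" where
  "reversed y x = p x * K x y / p y"

text \<open>The two properties trade places under reversal: invariance of \<open>p\<close> under
  \<open>K\<close> makes the reversed rows sum to 1, and the rows of \<open>K\<close> summing to 1
  makes \<open>p\<close> invariant under the reversal.\<close>

lemma reversed_invariant_kernel: "invariant_kernel V reversed p"
proof
  show "markov_kernel V reversed"
    unfolding markov_kernel_def
  proof (intro conjI ballI)
    fix y x assume y: "y \<in> V" and x: "x \<in> V"
    show "0 \<le> reversed y x"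
      using flow_nonneg[OF x y] pos[OF y] by (simp add: reversed_def)
    have "sum (\<lambda>x. p x * K x y) {x} \<le> p y"
      by (rule finite_sum_le_has_sum[OF inflow_has_sum[OF y]]) (use x y flow_nonneg in auto)
    then show "reversed y x \<le> 1" using pos[OF y] by (simp add: reversed_def)
  next
    fix y assume y: "y \<in> V"
    show "(reversed y has_sum 1) V"
      using has_sum_cmult_left[OF inflow_has_sum[OF y], of "1 / p y"] pos[OF y]
      by (simp add: reversed_def[abs_def])
  qed
  fix x assume x: "x \<in> V"
  have "act_measure V p reversed x = (\<Sum>\<^sub>\<infinity>y\<in>V. p x * K x y)"
    unfolding act_measure_def reversed_def using pos by (intro infsum_cong) (simp add: less_le)
  also have "\<dots> = p x"
    using has_sum_cmult_right[OF markov_kernel_has_sum[OF markov x], of "p x"]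
    by (simp add: infsumI)
  finally show "act_measure V p reversed x = p x" .
qed (fact pos summable)+

section \<open>Fubini for the flow \<open>p x * K x y\<close> and the action on square-summable
  functions\<close>

lemma joint_summable_source:
  assumes "(\<lambda>x. h x * p x) summable_on V"
  shows "(\<lambda>(x, y). p x * K x y * h x) summable_on V \<times> V"
proof (rule summable_on_dominated[OF markov_kernel_joint_summable[OF markov assms]])
  fix z assume "z \<in> V \<times> V"
  then show "\<bar>case z of (x, y) \<Rightarrow> p x * K x y * h x\<bar> \<le> (case z of (x, y) \<Rightarrow> \<bar>h x * p x\<bar> * K x y)"
    using markov_kernel_nonneg[OF markov] by (auto simp: abs_mult)
qed

text \<open>Since \<open>p x * K x y = p y * reversed y x\<close>, this is
  \<open>joint_summable_source\<close> for the reversed kernel with the coordinates swapped.\<close>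

lemma joint_summable_target:
  assumes "(\<lambda>x. h x * p x) summable_on V"
  shows "(\<lambda>(x, y). p x * K x y * h y) summable_on V \<times> V"
proof -
  interpret R: invariant_kernel V reversed p by (rule reversed_invariant_kernel)
  have "(\<lambda>(x, y). case (y, x) of (x, y) \<Rightarrow> p x * reversed x y * h x) summable_on V \<times> V"
    using R.joint_summable_source[OF assms] by (subst (asm) summable_on_swap) simp
  then show ?thesis
    by (rule summable_on_cong[THEN iffD1, rotated]) (use pos in \<open>fastforce simp: reversed_def\<close>)
qed

lemma
  assumes "(\<lambda>x. f x * p x) summable_on V"
  shows act_fun_summand_summable: "x \<in> V \<Longrightarrow> (\<lambda>y. K x y * f y) summable_on V"
    and act_fun_summable: "(\<lambda>x. act_fun V K f x * p x) summable_on V"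
    and act_fun_mean: "(\<Sum>\<^sub>\<infinity>x\<in>V. act_fun V K f x * p x) = (\<Sum>\<^sub>\<infinity>x\<in>V. f x * p x)"
proof -
  note joint = joint_summable_target[OF assms]
  show "(\<lambda>y. K x y * f y) summable_on V" if x: "x \<in> V"
  proof -
    \<comment> \<open>A section of the jointly summable family is summable, and its weight
      \<open>p x\<close> is positive, so it can be divided out.\<close>
    have "(\<lambda>y. p x * K x y * f y) summable_on V"
      using summable_on_SigmaD1[of "\<lambda>x y. p x * K x y * f y" V "\<lambda>_. V", OF joint x] .
    then have "(\<lambda>y. (1 / p x) * (p x * K x y * f y)) summable_on V"
      by (rule summable_on_cmult_right)
    then show ?thesis using pos[OF x] by simp
  qed
  have eq: "(\<Sum>\<^sub>\<infinity>y\<in>V. p x * K x y * f y) = act_fun V K f x * p x" for x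
    unfolding act_fun_def mult.assoc infsum_cmult_right' by (rule mult.commute)
  show "(\<lambda>x. act_fun V K f x * p x) summable_on V"
    using summable_on_Sigma_banach[OF joint] by (simp add: eq)
  have "(\<Sum>\<^sub>\<infinity>x\<in>V. act_fun V K f x * p x) = (\<Sum>\<^sub>\<infinity>y\<in>V. \<Sum>\<^sub>\<infinity>x\<in>V. p x * K x y * f y)"
    using infsum_swap_banach[OF joint] by (simp add: eq)
  also have "\<dots> = (\<Sum>\<^sub>\<infinity>y\<in>V. f y * p y)"
    using inflow_has_sum by (intro infsum_cong) (simp add: infsum_cmult_left' infsumI)
  finally show "(\<Sum>\<^sub>\<infinity>x\<in>V. act_fun V K f x * p x) = (\<Sum>\<^sub>\<infinity>x\<in>V. f x * p x)" .
qed

lemma l2_summable: "f \<in> l2_space V p \<Longrightarrow> (\<lambda>x. f x * p x) summable_on V"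
  using l2_space_summable[OF nonneg summable] .

text \<open>The gap between the two sides is the variance of \<open>f\<close> under
  \<open>K x\<close>, a sum of nonnegative terms \<open>K x y * (f y - ?m)\<^sup>2\<close>.\<close>

lemma act_fun_jensen:
  assumes f: "f \<in> l2_space V p" and x: "x \<in> V"
  shows "(act_fun V K f x)\<^sup>2 \<le> act_fun V K (\<lambda>y. (f y)\<^sup>2) x"
proof -
  let ?m = "act_fun V K f x"
  have s2: "(\<lambda>x. (f x)\<^sup>2 * p x) summable_on V" using f by (simp add: l2_space_def)
  have "((\<lambda>y. K x y * (f y)\<^sup>2 - 2 * ?m * (K x y * f y) + ?m\<^sup>2 * K x y) has_sum
      act_fun V K (\<lambda>y. (f y)\<^sup>2) x - 2 * ?m * ?m + ?m\<^sup>2 * 1) V"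
    using act_fun_summand_summable[OF l2_summable[OF f] x] act_fun_summand_summable[OF s2 x]
    unfolding act_fun_def
    by (intro has_sum_add has_sum_diff_real has_sum_cmult_right
        markov_kernel_has_sum[OF markov x] has_sum_infsum)
  moreover have "K x y * (f y)\<^sup>2 - 2 * ?m * (K x y * f y) + ?m\<^sup>2 * K x y = K x y * (f y - ?m)\<^sup>2" for y
    by (simp add: power2_eq_square algebra_simps)
  ultimately have "((\<lambda>y. K x y * (f y - ?m)\<^sup>2) has_sum act_fun V K (\<lambda>y. (f y)\<^sup>2) x - ?m\<^sup>2) V"
    by (simp add: power2_eq_square)
  then have "0 \<le> act_fun V K (\<lambda>y. (f y)\<^sup>2) x - ?m\<^sup>2"
    by (rule has_sum_nonneg) (use markov_kernel_nonneg[OF markov x] in auto)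
  then show ?thesis by simp
qed

text \<open>Jensen's inequality is summed against \<open>p\<close>; invariance gives
  \<open>K f\<^sup>2\<close> the same \<open>p\<close>-integral as \<open>f\<^sup>2\<close>.\<close>

lemma
  assumes f: "f \<in> l2_space V p"
  shows act_fun_l2: "act_fun V K f \<in> l2_space V p"
    and act_fun_contraction: "(\<Sum>\<^sub>\<infinity>x\<in>V. (act_fun V K f x)\<^sup>2 * p x) \<le> (\<Sum>\<^sub>\<infinity>x\<in>V. (f x)\<^sup>2 * p x)"
proof -
  have s2: "(\<lambda>x. (f x)\<^sup>2 * p x) summable_on V" using f by (simp add: l2_space_def)
  have le: "(act_fun V K f x)\<^sup>2 * p x \<le> act_fun V K (\<lambda>y. (f y)\<^sup>2) x * p x" if "x \<in> V" for x
    using act_fun_jensen[OF f that] nonneg[OF that] by (rule mult_right_mono)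
  have s: "(\<lambda>x. (act_fun V K f x)\<^sup>2 * p x) summable_on V"
    by (rule summable_on_dominated[OF act_fun_summable[OF s2]]) (use le nonneg in auto)
  then show "act_fun V K f \<in> l2_space V p" by (simp add: l2_space_def)
  show "(\<Sum>\<^sub>\<infinity>x\<in>V. (act_fun V K f x)\<^sup>2 * p x) \<le> (\<Sum>\<^sub>\<infinity>x\<in>V. (f x)\<^sup>2 * p x)"
    using infsum_mono[OF s act_fun_summable[OF s2] le] act_fun_mean[OF s2] by simp
qed

lemma joint_summable_product:
  assumes f: "f \<in> l2_space V p" and g: "g \<in> l2_space V p"
  shows "(\<lambda>(x, y). p x * K x y * (g x * f y)) summable_on V \<times> V"
proof (rule summable_on_dominated)
  show "(\<lambda>z. (case z of (x, y) \<Rightarrow> p x * K x y * (g x)\<^sup>2) + (case z of (x, y) \<Rightarrow> p x * K x y * (f y)\<^sup>2))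
      summable_on V \<times> V"
    using f g by (intro summable_on_add joint_summable_source joint_summable_target)
      (auto simp: l2_space_def)
  fix z assume "z \<in> V \<times> V"
  then obtain x y where z: "z = (x, y)" "x \<in> V" "y \<in> V" by auto
  show "\<bar>case z of (x, y) \<Rightarrow> p x * K x y * (g x * f y)\<bar>
      \<le> (case z of (x, y) \<Rightarrow> p x * K x y * (g x)\<^sup>2) + (case z of (x, y) \<Rightarrow> p x * K x y * (f y)\<^sup>2)"
    using mult_left_mono[OF abs_mult_le_squares[of "g x" "f y"] flow_nonneg[OF z(2,3)]]
      flow_nonneg[OF z(2,3)] z(1)
    by (simp add: abs_mult[of "p x * K x y"] distrib_left)
qed

text \<open>Provides an actual adjoint, so that the choice in \<open>l2_adjoint\<close> is not
  vacuous.\<close>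

lemma reversed_is_l2_adjoint: "is_l2_adjoint V p (act_fun V K) (act_fun V reversed)"
proof -
  interpret R: invariant_kernel V reversed p by (rule reversed_invariant_kernel)
  have "l2_inner V p (act_fun V K f) g = l2_inner V p f (act_fun V reversed g)"
    if f: "f \<in> l2_space V p" and g: "g \<in> l2_space V p" for f g
  proof -
    have "l2_inner V p (act_fun V K f) g = (\<Sum>\<^sub>\<infinity>x\<in>V. \<Sum>\<^sub>\<infinity>y\<in>V. p x * K x y * (g x * f y))"
    proof -
      have "act_fun V K f x * g x * p x = (\<Sum>\<^sub>\<infinity>y\<in>V. K x y * f y * (g x * p x))" for x
        unfolding act_fun_def infsum_cmult_left' by (rule mult.assoc)
      then show ?thesis by (simp add: l2_inner_def mult_ac)
    qed
    also have "\<dots> = (\<Sum>\<^sub>\<infinity>y\<in>V. \<Sum>\<^sub>\<infinity>x\<in>V. p x * K x y * (g x * f y))"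
      by (rule infsum_swap_banach[OF joint_summable_product[OF f g]])
    also have "\<dots> = (\<Sum>\<^sub>\<infinity>y\<in>V. \<Sum>\<^sub>\<infinity>x\<in>V. f y * p y * (reversed y x * g x))"
      using pos by (intro infsum_cong) (fastforce simp: reversed_def)
    also have "\<dots> = l2_inner V p f (act_fun V reversed g)"
      unfolding l2_inner_def act_fun_def infsum_cmult_right' by (simp add: mult_ac)
    finally show ?thesis .
  qed
  then show ?thesis
    unfolding is_l2_adjoint_def using R.act_fun_l2 by blast
qed

text \<open>By adjointness the form is the squared norm of \<open>f\<close> minus that of
  \<open>K f\<close>. The means of \<open>f\<close> and \<open>K f\<close> coincide, so their
  squares cancel in the difference of variances.\<close>

lemma dirichlet_form_eq_variance_drop:
  assumes f: "f \<in> l2_space V p"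
  shows "dirichlet_form V p (l2_adjoint V p (act_fun V K) \<circ> act_fun V K) f
    = variance_of V p f - variance_of V p (act_fun V K f)"
proof -
  let ?B = "l2_adjoint V p (act_fun V K)" and ?g = "act_fun V K f"
  have adj: "is_l2_adjoint V p (act_fun V K) ?B"
    unfolding l2_adjoint_def using someI[of "is_l2_adjoint V p (act_fun V K)", OF reversed_is_l2_adjoint] .
  note g = act_fun_l2[OF f]
  have Bg: "?B ?g \<in> l2_space V p"
    and inner: "l2_inner V p f (?B ?g) = l2_inner V p ?g ?g"
    using adj g f by (auto simp: is_l2_adjoint_def)
  have s: "(\<lambda>x. f x * ?B ?g x * p x) summable_on V"
  proof (rule summable_on_dominated)
    show "(\<lambda>x. (f x)\<^sup>2 * p x + (?B ?g x)\<^sup>2 * p x) summable_on V"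
      using f Bg by (auto simp: l2_space_def intro: summable_on_add)
    fix x assume x: "x \<in> V"
    show "\<bar>f x * ?B ?g x * p x\<bar> \<le> (f x)\<^sup>2 * p x + (?B ?g x)\<^sup>2 * p x"
      using mult_right_mono[OF abs_mult_le_squares[of "f x" "?B ?g x"] nonneg[OF x]] nonneg[OF x]
      by (simp add: abs_mult distrib_right)
  qed
  have "((\<lambda>x. (f x)\<^sup>2 * p x - f x * ?B ?g x * p x) has_sum
      (\<Sum>\<^sub>\<infinity>x\<in>V. (f x)\<^sup>2 * p x) - l2_inner V p f (?B ?g)) V"
    unfolding l2_inner_def using f s
    by (intro has_sum_diff_real has_sum_infsum) (auto simp: l2_space_def)
  moreover have "(f x - ?B ?g x) * f x * p x = (f x)\<^sup>2 * p x - f x * ?B ?g x * p x" for x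
    by (simp add: power2_eq_square algebra_simps)
  ultimately have "dirichlet_form V p (?B \<circ> act_fun V K) f
      = (\<Sum>\<^sub>\<infinity>x\<in>V. (f x)\<^sup>2 * p x) - l2_inner V p ?g ?g"
    unfolding dirichlet_form_def inner[symmetric] by (simp add: l2_inner_def[of V p "\<lambda>x. _ x - _ x"] infsumI)
  then show ?thesis
    by (simp add: variance_of_def act_fun_mean[OF l2_summable[OF f]] l2_inner_def power2_eq_square)
qed

end

section \<open>The Poincare constant\<close>

text \<open>\<open>GREATEST\<close> is meaningful only if a maximum exists. The admissible constants
  contain 0, are bounded above by \<open>e j / v j\<close>, and form a closed set, so their supremum
  is admissible and is the greatest element.\<close>

lemma Greatest_linear_bound:
  fixes v e :: "'b \<Rightarrow> real"
  assumes v: "\<And>i. i \<in> I \<Longrightarrow> 0 \<le> v i" and e: "\<And>i. i \<in> I \<Longrightarrow> 0 \<le> e i"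
    and j: "j \<in> I" "0 < v j" and i: "i \<in> I"
  shows "(GREATEST c. \<forall>i\<in>I. c * v i \<le> e i) * v i \<le> e i"
proof -
  define S where "S = {c. \<forall>i\<in>I. c * v i \<le> e i}"
  have le: "c \<le> e i / v i" if "c \<in> S" "i \<in> I" "0 < v i" for c i
    using that by (simp add: S_def pos_le_divide_eq)
  have bdd: "bdd_above S" using le[OF _ j] by (rule bdd_aboveI)
  have ne: "S \<noteq> {}" using e by (auto simp: S_def intro: exI[of _ 0])
  have Sup: "Sup S * v i \<le> e i" if i: "i \<in> I" for i
  proof (cases "v i = 0")
    case False
    then have "0 < v i" using v[OF i] by simp
    then show ?thesis
      using cSup_least[OF ne le[OF _ i]] by (simp add: pos_le_divide_eq)
  qed (simp add: e[OF i])
  have "(GREATEST c. \<forall>i\<in>I. c * v i \<le> e i) = Sup S"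
    using Sup cSup_upper[OF _ bdd] by (intro Greatest_equality) (auto simp: S_def)
  then show ?thesis using Sup[OF i] by simp
qed

context invariant_kernel
begin

text \<open>The variance is \<open>p a * (1 - p a)\<close>, and \<open>p a < 1\<close> because
  \<open>b\<close> also carries mass. This supplies the non-constant function that bounds the
  Poincare constants from above.\<close>

lemma indicator_variance_pos:
  assumes M: "mass V p = 1" and ab: "a \<in> V" "b \<in> V" "a \<noteq> b"
  shows "0 < variance_of V p (\<lambda>x. if x = a then 1 else 0)"
proof -
  have 1: "(\<Sum>\<^sub>\<infinity>x\<in>V. (if x = a then 1 else 0) * p x) = p a"
    using ab by (intro infsumI has_sum_finite_neutralI[of "{a}"]) auto
  have 2: "(\<Sum>\<^sub>\<infinity>x\<in>V. (if x = a then 1 else 0)\<^sup>2 * p x) = p a"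
    using ab by (intro infsumI has_sum_finite_neutralI[of "{a}"]) auto
  have "sum p {a, b} \<le> mass V p"
    unfolding mass_def using ab nonneg by (intro finite_sum_le_infsum[OF summable]) auto
  then have "p a < 1" using ab pos[OF ab(2)] M by simp
  then have "0 < p a * (1 - p a)" using pos[OF ab(1)] by simp
  then show ?thesis
    unfolding variance_of_def 1 2 by (simp add: power2_eq_square algebra_simps)
qed

lemma
  assumes M: "mass V p = 1" and ab: "a \<in> V" "b \<in> V" "a \<noteq> b"
  defines "\<gamma> \<equiv> poincare_const V p (l2_adjoint V p (act_fun V K) \<circ> act_fun V K)"
  shows variance_contraction: "f \<in> l2_space V p \<Longrightarrow>
      variance_of V p (act_fun V K f) \<le> (1 - \<gamma>) * variance_of V p f"
    and poincare_const_le_1: "\<gamma> \<le> 1"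
proof -
  let ?E = "dirichlet_form V p (l2_adjoint V p (act_fun V K) \<circ> act_fun V K)"
  let ?j = "\<lambda>x. if x = a then 1 else 0 :: real"
  have j: "?j \<in> l2_space V p" using nonneg summable by (intro l2_space_bounded) auto
  have var_nonneg: "0 \<le> variance_of V p f" if "f \<in> l2_space V p" for f
    using spread_nonneg[OF nonneg summable that] M by (simp add: variance_of_eq_spread)
  have E_nonneg: "0 \<le> ?E f" if f: "f \<in> l2_space V p" for f
    using act_fun_contraction[OF f]
    by (simp add: dirichlet_form_eq_variance_drop[OF f] variance_of_def act_fun_mean[OF l2_summable[OF f]])
  have poincare: "\<gamma> * variance_of V p f \<le> ?E f" if f: "f \<in> l2_space V p" for f
    unfolding \<gamma>_def poincare_const_def
    by (rule Greatest_linear_bound[where v = "variance_of V p" and e = ?E,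
          OF var_nonneg E_nonneg j indicator_variance_pos[OF M ab] f])
  show contr: "variance_of V p (act_fun V K f) \<le> (1 - \<gamma>) * variance_of V p f"
    if "f \<in> l2_space V p" for f
    using poincare[OF that] dirichlet_form_eq_variance_drop[OF that] by (simp add: algebra_simps)
  \<comment> \<open>The contraction applied to the indicator bounds this product below by a
    variance; as the variance of \<open>?j\<close> is positive, \<open>1 - \<gamma>\<close> cannot
    be negative.\<close>
  have "0 \<le> (1 - \<gamma>) * variance_of V p ?j"
    using contr[OF j] var_nonneg[OF act_fun_l2[OF j]] by linarith
  then show "\<gamma> \<le> 1"
    using indicator_variance_pos[OF M ab] by (simp add: zero_le_mult_iff)
qed

lemma normalized_invariant_kernel:
  assumes "V \<noteq> {}"
  shows "invariant_kernel V K (normalized V p)"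
proof
  note M = mass_pos[OF pos summable assms]
  show "0 < normalized V p x" if "x \<in> V" for x using pos[OF that] M by (simp add: normalized_def)
  show "normalized V p summable_on V"
    using summable_on_cmult_left[OF summable, of "1 / mass V p"] by (simp add: normalized_def[abs_def])
  show "act_measure V (normalized V p) K x = normalized V p x" if "x \<in> V" for x
  proof -
    have "act_measure V (normalized V p) K x = (\<Sum>\<^sub>\<infinity>y\<in>V. (1 / mass V p) * (p y * K y x))"
      by (simp add: act_measure_def normalized_def)
    also have "\<dots> = normalized V p x"
      unfolding infsum_cmult_right' using invariant[OF that]
      by (simp add: act_measure_def normalized_def)
    finally show ?thesis .
  qed
qed (fact markov)

lemma
  assumes ab: "a \<in> V" "b \<in> V" "a \<noteq> b"
  defines "\<gamma> \<equiv> poincare_const V (normalized V p) (l2_adjoint V (normalized V p) (act_fun V K) \<circ> act_fun V K)"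
  shows spread_contraction: "f \<in> l2_space V p \<Longrightarrow>
      spread V p (act_fun V K f) \<le> (1 - \<gamma>) * spread V p f"
    and normalized_poincare_const_le_1: "\<gamma> \<le> 1"
proof -
  have ne: "V \<noteq> {}" using ab by auto
  interpret N: invariant_kernel V K "normalized V p" by (rule normalized_invariant_kernel[OF ne])
  note M = mass_pos[OF pos summable ne]
  note M1 = mass_normalized[OF M]
  show "\<gamma> \<le> 1" unfolding \<gamma>_def by (rule N.poincare_const_le_1[OF M1 ab])
  assume "f \<in> l2_space V p"
  then have "f \<in> l2_space V (normalized V p)"
    using summable_on_cmult_left[of "\<lambda>x. (f x)\<^sup>2 * p x" V "1 / mass V p"]
    by (simp add: l2_space_def normalized_def)
  from N.variance_contraction[OF M1 ab this, folded \<gamma>_def]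
  have "spread V p (act_fun V K f) / mass V p \<le> (1 - \<gamma>) * spread V p f / mass V p"
    by (simp only: variance_of_normalized times_divide_eq_right)
  then show "spread V p (act_fun V K f) \<le> (1 - \<gamma>) * spread V p f"
    using M by (simp add: divide_le_cancel)
qed

end

section \<open>Non-decreasing environments\<close>

locale nondecreasing_environment =
  fixes V :: "'a set" and K :: "nat \<Rightarrow> 'a \<Rightarrow> 'a \<Rightarrow> real" and \<pi> :: "nat \<Rightarrow> 'a \<Rightarrow> real"
  assumes two_points: "\<exists>a\<in>V. \<exists>b\<in>V. a \<noteq> b"
    and markov: "t \<ge> 1 \<Longrightarrow> markov_kernel V (K t)"
    and environment: "finite_nondecreasing_environment V K \<pi>"
begin

lemma invariant_kernel:
  assumes t: "t \<ge> 1"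
  shows "invariant_kernel V (K t) (\<pi> t)"
  using markov[OF t] environment[unfolded finite_nondecreasing_environment_def, rule_format, OF t]
  by (simp add: invariant_kernel_def)

lemma nonneg: "t \<ge> 1 \<Longrightarrow> x \<in> V \<Longrightarrow> 0 \<le> \<pi> t x"
  using invariant_kernel.nonneg[OF invariant_kernel] .

lemma summable: "t \<ge> 1 \<Longrightarrow> \<pi> t summable_on V"
  using invariant_kernel.summable[OF invariant_kernel] .

lemma mass_pos:
  assumes t: "t \<ge> 1"
  shows "0 < mass V (\<pi> t)"
proof (rule Submission.mass_pos[OF invariant_kernel.pos[OF invariant_kernel[OF t]] summable[OF t]])
  show "V \<noteq> {}" using two_points by blast
qed

lemma step_contraction:
  assumes "t \<ge> 1" and "f \<in> l2_space V (\<pi> t)"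
  shows "spread V (\<pi> t) (act_fun V (K t) f) \<le> (1 - env_gamma V K \<pi> t) * spread V (\<pi> t) f"
proof -
  obtain a b where ab: "a \<in> V" "b \<in> V" "a \<noteq> b" using two_points by blast
  show ?thesis
    unfolding env_gamma_def Let_def
    by (rule invariant_kernel.spread_contraction[OF invariant_kernel[OF assms(1)] ab assms(2)])
qed

lemma env_gamma_le_1:
  assumes "t \<ge> 1"
  shows "env_gamma V K \<pi> t \<le> 1"
proof -
  obtain a b where ab: "a \<in> V" "b \<in> V" "a \<noteq> b" using two_points by blast
  show ?thesis
    unfolding env_gamma_def Let_def
    by (rule invariant_kernel.normalized_poincare_const_le_1[OF invariant_kernel[OF assms] ab])
qed

section \<open>Expectations under the law of the chain\<close>

lemma chain_law_summable:
  assumes "x \<in> V"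
  shows "chain_law V K x t summable_on V"
proof (induction t)
  case 0
  have "(point_mass x has_sum 1) V"
    using assms by (intro has_sum_finite_neutralI[of "{x}"]) (auto simp: point_mass_def)
  then show ?case by (simp add: has_sum_imp_summable)
next
  case (Suc t)
  \<comment> \<open>The zero function only discharges the premise on a test function bounded by
    1.\<close>
  then show ?case using act_measure_summable[OF markov Suc, of "Suc t" "\<lambda>_. 0"] by simp
qed

lemma chain_law_test_summable:
  assumes "x \<in> V" and f: "\<And>z. z \<in> V \<Longrightarrow> \<bar>f z\<bar> \<le> 1"
  shows "(\<lambda>z. chain_law V K x t z * f z) summable_on V"
  using f by (intro summable_on_dominated[OF summable_on_abs[OF chain_law_summable[OF assms(1), of t]]])
    (auto simp: abs_mult mult_left_le)

lemma chain_law_Suc_expectation: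
  assumes "x \<in> V" and "\<And>z. z \<in> V \<Longrightarrow> \<bar>f z\<bar> \<le> 1"
  shows "(\<Sum>\<^sub>\<infinity>z\<in>V. chain_law V K x (Suc t) z * f z)
    = (\<Sum>\<^sub>\<infinity>z\<in>V. chain_law V K x t z * act_fun V (K (Suc t)) f z)"
  using act_measure_duality[OF markov chain_law_summable[OF assms(1)] assms(2)] by simp

lemma chain_law_0_expectation:
  assumes "x \<in> V"
  shows "(\<Sum>\<^sub>\<infinity>z\<in>V. chain_law V K x 0 z * f z) = f x"
  using assms by (intro infsumI has_sum_finite_neutralI[of "{x}"]) (auto simp: point_mass_def)

lemma chain_law_expectation_bounded:
  assumes "x \<in> V" and "\<And>z. z \<in> V \<Longrightarrow> \<bar>f z\<bar> \<le> 1"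
  shows "\<bar>\<Sum>\<^sub>\<infinity>z\<in>V. chain_law V K x t z * f z\<bar> \<le> 1"
  using assms(2)
proof (induction t arbitrary: f)
  case 0
  then show ?case using chain_law_0_expectation[OF assms(1)] assms(1) by simp
next
  case (Suc t)
  then show ?case
    using Suc.IH[of "act_fun V (K (Suc t)) f"] act_fun_abs_le[OF markov Suc.prems, of "Suc t"]
    by (simp add: chain_law_Suc_expectation[OF assms(1)] del: chain_law.simps)
qed

text \<open>Induction that moves the last kernel from the law onto the test function, hence
  \<open>f\<close> is arbitrary. The index \<open>Suc t\<close> starts the induction at time 1, as
  nothing is assumed about \<open>\<pi> 0\<close>.\<close>

lemma spread_chain_law_expectation:
  assumes "\<And>z. z \<in> V \<Longrightarrow> \<bar>f z\<bar> \<le> 1"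
  shows "spread V (\<pi> 1) (\<lambda>x. \<Sum>\<^sub>\<infinity>z\<in>V. chain_law V K x (Suc t) z * f z)
    \<le> (\<Prod>s=1..Suc t. 1 - env_gamma V K \<pi> s) * spread V (\<pi> (Suc t)) f"
  using assms
proof (induction t arbitrary: f)
  case 0
  have "spread V (\<pi> 1) (\<lambda>x. \<Sum>\<^sub>\<infinity>z\<in>V. chain_law V K x (Suc 0) z * f z)
      = spread V (\<pi> 1) (act_fun V (K 1) f)"
    by (rule spread_cong)
      (simp add: chain_law_Suc_expectation[OF _ 0] chain_law_0_expectation del: chain_law.simps)
  then show ?case
    using step_contraction[OF _ l2_space_bounded[OF nonneg summable 0], of 1] by simp
next
  case (Suc t)
  let ?g = "act_fun V (K (Suc (Suc t))) f"
  let ?P = "\<Prod>s=1..Suc t. 1 - env_gamma V K \<pi> s"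
  have g: "\<bar>?g z\<bar> \<le> 1" if "z \<in> V" for z
    using act_fun_abs_le[OF markov Suc.prems that] by simp
  have gl2: "?g \<in> l2_space V (\<pi> (Suc (Suc t)))"
    by (rule l2_space_bounded[OF nonneg summable g]) auto
  have fl2: "f \<in> l2_space V (\<pi> (Suc (Suc t)))"
    by (rule l2_space_bounded[OF nonneg summable Suc.prems]) auto
  have P: "0 \<le> ?P" using env_gamma_le_1 by (intro prod_nonneg) simp
  have mono: "\<pi> (Suc t) z \<le> \<pi> (Suc (Suc t)) z" if "z \<in> V" for z
    using environment that unfolding finite_nondecreasing_environment_def
    by (metis Suc_eq_plus1 le_add2)
  have "spread V (\<pi> 1) (\<lambda>x. \<Sum>\<^sub>\<infinity>z\<in>V. chain_law V K x (Suc (Suc t)) z * f z)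
      = spread V (\<pi> 1) (\<lambda>x. \<Sum>\<^sub>\<infinity>z\<in>V. chain_law V K x (Suc t) z * ?g z)"
    by (rule spread_cong) (rule chain_law_Suc_expectation[OF _ Suc.prems])
  also have "\<dots> \<le> ?P * spread V (\<pi> (Suc t)) ?g"
    by (rule Suc.IH[OF g])
  \<comment> \<open>The induction hypothesis ends at the measure of time \<open>Suc t\<close>, while
    the last kernel contracts the spread of its own invariant measure; growth of the environment
    bridges the two.\<close>
  also have "\<dots> \<le> ?P * spread V (\<pi> (Suc (Suc t))) ?g"
    by (intro mult_left_mono[OF _ P] spread_mono[OF nonneg summable mass_pos mono summable mass_pos gl2]) auto
  also have "\<dots> \<le> ?P * ((1 - env_gamma V K \<pi> (Suc (Suc t))) * spread V (\<pi> (Suc (Suc t))) f)"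
    by (intro mult_left_mono[OF step_contraction[OF _ fl2] P]) simp
  finally show ?case by (simp add: mult.assoc)
qed

lemma tv_dist_bound:
  assumes x: "x \<in> V" and y: "y \<in> V" and t: "t \<ge> 1"
  shows "tv_dist V (chain_law V K x t) (chain_law V K y t)
    \<le> 1/2 * sqrt (mass V (\<pi> t) / mass V (\<pi> 1)) *
       (1 / sqrt (normalized V (\<pi> 1) x) + 1 / sqrt (normalized V (\<pi> 1) y)) *
       (\<Prod>s=1..t. sqrt (1 - env_gamma V K \<pi> s))"
proof -
  \<comment> \<open>The sign of the difference turns the sum of absolute values into a difference of
    expectations.\<close>
  define f where "f z = sgn (chain_law V K x t z - chain_law V K y t z)" for z
  define h where "h x = (\<Sum>\<^sub>\<infinity>z\<in>V. chain_law V K x t z * f z)" for x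
  \<comment> \<open>A common centre for \<open>h x\<close> and \<open>h y\<close>: the mean of
    \<open>h\<close> under the normalized initial measure.\<close>
  define m where "m = (\<Sum>\<^sub>\<infinity>x\<in>V. h x * \<pi> 1 x) / mass V (\<pi> 1)"
  let ?P = "\<Prod>s=1..t. 1 - env_gamma V K \<pi> s"
  have f: "\<bar>f z\<bar> \<le> 1" for z by (simp add: f_def sgn_if)
  have "(\<Sum>\<^sub>\<infinity>z\<in>V. \<bar>chain_law V K x t z - chain_law V K y t z\<bar>)
      = (\<Sum>\<^sub>\<infinity>z\<in>V. chain_law V K x t z * f z - chain_law V K y t z * f z)"
    by (intro infsum_cong) (auto simp: f_def sgn_if)
  also have "\<dots> = h x - h y"
    unfolding h_def using chain_law_test_summable[OF _ f] x y
    by (intro infsumI has_sum_diff_real has_sum_infsum) auto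
  finally have tv: "tv_dist V (chain_law V K x t) (chain_law V K y t) = 1/2 * (h x - h y)"
    by (simp add: tv_dist_def)
  have h_l2: "h \<in> l2_space V (\<pi> 1)"
    unfolding h_def
    by (rule l2_space_bounded[OF nonneg summable chain_law_expectation_bounded[OF _ f]]) auto
  have P: "0 \<le> ?P" using env_gamma_le_1 by (intro prod_nonneg) simp
  obtain n where n: "t = Suc n" using t by (cases t) auto
  have "spread V (\<pi> 1) h \<le> ?P * spread V (\<pi> t) f"
    unfolding h_def n using spread_chain_law_expectation[OF f] .
  also have "\<dots> \<le> ?P * mass V (\<pi> t)"
    by (intro mult_left_mono[OF spread_bounded_le_mass P] nonneg summable mass_pos f t)
  finally have S: "sqrt (spread V (\<pi> 1) h) \<le> sqrt ?P * sqrt (mass V (\<pi> t))"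
    by (simp flip: real_sqrt_mult)
  have dev: "\<bar>h z - m\<bar> \<le> sqrt ?P * sqrt (mass V (\<pi> t)) / sqrt (\<pi> 1 z)" if z: "z \<in> V" for z
  proof -
    have "\<bar>h z - m\<bar> \<le> sqrt (spread V (\<pi> 1) h) / sqrt (\<pi> 1 z)"
      unfolding m_def
      by (rule deviation_le_spread[OF invariant_kernel.pos[OF invariant_kernel] summable h_l2 z]) auto
    also have "\<dots> \<le> sqrt ?P * sqrt (mass V (\<pi> t)) / sqrt (\<pi> 1 z)"
      using S nonneg[OF _ z, of 1] by (intro divide_right_mono) auto
    finally show ?thesis .
  qed
  \<comment> \<open>The factor \<open>1 / sqrt (mass V (\<pi> 1))\<close> split off here joins
    \<open>sqrt (mass V (\<pi> t))\<close> to form the mass ratio.\<close>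
  have root: "1 / sqrt (\<pi> 1 z) = 1 / sqrt (normalized V (\<pi> 1) z) / sqrt (mass V (\<pi> 1))" for z
    using mass_pos[of 1] by (simp add: normalized_def real_sqrt_divide)
  have "h x - h y \<le> \<bar>h x - m\<bar> + \<bar>h y - m\<bar>" by linarith
  also have "\<dots> \<le> sqrt ?P * sqrt (mass V (\<pi> t)) * (1 / sqrt (\<pi> 1 x) + 1 / sqrt (\<pi> 1 y))"
    using dev[OF x] dev[OF y] by (simp add: algebra_simps)
  also have "\<dots> = sqrt (mass V (\<pi> t) / mass V (\<pi> 1)) *
       (1 / sqrt (normalized V (\<pi> 1) x) + 1 / sqrt (normalized V (\<pi> 1) y)) * sqrt ?P"
    unfolding root real_sqrt_divide add_divide_distrib[symmetric] by simp
  also have "sqrt ?P = (\<Prod>s=1..t. sqrt (1 - env_gamma V K \<pi> s))"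
    by (induction t) (simp_all add: real_sqrt_mult)
  finally have "1/2 * (h x - h y) \<le> 1/2 * (sqrt (mass V (\<pi> t) / mass V (\<pi> 1)) *
       (1 / sqrt (normalized V (\<pi> 1) x) + 1 / sqrt (normalized V (\<pi> 1) y)) *
       (\<Prod>s=1..t. sqrt (1 - env_gamma V K \<pi> s)))"
    by (rule mult_left_mono) simp
  then show ?thesis unfolding tv by (simp only: mult.assoc)
qed

end

theorem theorem1p8:
  fixes V :: "'a set"
    and K :: "nat \<Rightarrow> 'a \<Rightarrow> 'a \<Rightarrow> real"
    and \<pi> :: "nat \<Rightarrow> 'a \<Rightarrow> real"
  assumes "countable V"
    and "\<exists>a\<in>V. \<exists>b\<in>V. a \<noteq> b"
    and "\<And>t. t \<ge> 1 \<Longrightarrow> markov_kernel V (K t)"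
    and "\<And>t. t \<ge> 1 \<Longrightarrow> irreducible_kernel V (K t)"
    and "\<And>t. t \<ge> 1 \<Longrightarrow> aperiodic_kernel V (K t)"
    and "finite_nondecreasing_environment V K \<pi>"
  shows "\<forall>x\<in>V. \<forall>y\<in>V.
      (\<forall>t\<ge>1. tv_dist V (chain_law V K x t) (chain_law V K y t)
             \<le> 1/2 * sqrt (mass V (\<pi> t) / mass V (\<pi> 1)) *
                (1 / sqrt (normalized V (\<pi> 1) x) + 1 / sqrt (normalized V (\<pi> 1) y)) *
                (\<Prod>s=1..t. sqrt (1 - env_gamma V K \<pi> s))) \<and>
      (\<forall>\<eta>. 0 < \<eta> \<and> \<eta> < 1 \<longrightarrow>
         merging_time V K x y \<eta>
           \<le> Inf {enat t | t. 1 \<le> t \<and>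
               1/2 * sqrt (mass V (\<pi> t) / mass V (\<pi> 1)) *
                (1 / sqrt (normalized V (\<pi> 1) x) + 1 / sqrt (normalized V (\<pi> 1) y)) *
                (\<Prod>s=1..t. sqrt (1 - env_gamma V K \<pi> s)) \<le> \<eta>})"
proof (intro ballI conjI allI impI)
  interpret nondecreasing_environment V K \<pi>
    by standard (use assms in auto)
  fix x y assume x: "x \<in> V" and y: "y \<in> V"
  show "tv_dist V (chain_law V K x t) (chain_law V K y t)
      \<le> 1/2 * sqrt (mass V (\<pi> t) / mass V (\<pi> 1)) *
         (1 / sqrt (normalized V (\<pi> 1) x) + 1 / sqrt (normalized V (\<pi> 1) y)) *
         (\<Prod>s=1..t. sqrt (1 - env_gamma V K \<pi> s))" if "t \<ge> 1" for t
    by (rule tv_dist_bound[OF x y that])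
  then show "merging_time V K x y \<eta>
      \<le> Inf {enat t | t. 1 \<le> t \<and>
          1/2 * sqrt (mass V (\<pi> t) / mass V (\<pi> 1)) *
           (1 / sqrt (normalized V (\<pi> 1) x) + 1 / sqrt (normalized V (\<pi> 1) y)) *
           (\<Prod>s=1..t. sqrt (1 - env_gamma V K \<pi> s)) \<le> \<eta>}" for \<eta>
    \<comment> \<open>Any time at which the bound is at most \<open>\<eta>\<close> is a merging time
      candidate, and enlarging a set can only lower its infimum; an empty smaller set gives infinity
      on the right.\<close>
    unfolding merging_time_def by (intro Inf_superset_mono) (blast intro: order_trans)
qed

end
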